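(* (i) The two-sided sequent calculus $\mathbf{TS\text{-}Six}$ is sound and complete with respect to the matrix $\mathcal{M}_6$; that is, a sequent $\Gamma\Rightarrow\Delta$ is provable in $\mathbf{TS\text{-}Six}$ if and only if it is valid in $\mathcal{M}_6$. (ii) The cut rule $$\frac{\Gamma\Rightarrow\Delta,\alpha\qquad \alpha,\Gamma\Rightarrow\Delta}{\Gamma\Rightarrow\Delta}$$ is admissible in $\mathbf{TS\text{-}Six}$; that is, whenever both premises are provable in $\mathbf{TS\text{-}Six}$, so is the conclusion.
   Context: Formulas are built from a denumerable set of propositional variables with the binary connectives $\wedge,\vee$ and the unary connectives $\neg,\nabla$. A sequent $\Gamma\Rightarrow\Delta$ is a pair of finite (possibly empty) sets of formulas; commas denote union. The matrix $\mathcal{M}_6$: the set of truth values is $\mathcal{T}_6=\{\mathbf 0,\frac13,\mathbf n,\mathbf b,\frac23,\mathbf 1\}$, ordered as the lattice $\mathbf 0<\frac13<\mathbf n<\frac23<\mathbf 1$ and $\frac13<\mathbf b<\frac23$, with $\mathbf n,\mathbf b$ incomparable. The designated values are $\mathcal{D}=\{\mathbf b,\frac23,\mathbf 1\}$. The connectives are interpreted by $x\hat\wedge y=\inf\{x,y\}$, $x\hat\vee y=\sup\{x,y\}$; $\hat\neg\mathbf 0=\mathbf 1$, $\hat\neg\frac13=\frac23$, $\hat\neg\mathbf n=\mathbf n$, $\hat\neg\mathbf b=\mathbf b$, $\hat\neg\frac23=\frac13$, $\hat\neg\mathbf 1=\mathbf 0$; $\hat\nabla\mathbf 0=\mathbf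 0$ and $\hat\nabla x=\mathbf 1$ for $x\neq\mathbf 0$. A valuation is a map $v$ from formulas to $\mathcal{T}_6$ commuting with the connectives. A sequent $\Gamma\Rightarrow\Delta$ is satisfied by $v$ if $v(\gamma)\notin\mathcal{D}$ for some $\gamma\in\Gamma$ or $v(\delta)\in\mathcal{D}$ for some $\delta\in\Delta$; it is valid in $\mathcal{M}_6$ if satisfied by every valuation. The calculus $\mathbf{SF\text{-}Six}$ derives finite sets of signed formulas $t:\psi$ ($t\in\mathcal{T}_6$, $\psi$ a formula); $\Omega$ ranges over such sets. Axioms: $\{t:\alpha\mid t\in\mathcal{T}_6\}$ for each formula $\alpha$. Weakening: from $\Omega$ infer $\Omega'$ if $\Omega\subseteq\Omega'$. Logical rules, for all $i,j\in\mathcal{T}_6$: from $\Omega,i:\alpha$ and $\Omega,j:\beta$ infer $\Omega,\sup\{i,j\}:\alpha\vee\beta$; from $\Omega,i:\alpha$ and $\Omega,j:\beta$ infer $\Omega,\inf\{i,j\}:\alpha\wedge\beta$; from $\Omega,i:\alpha$ infer $\Omega,\hat\neg i:\neg\alpha$; from $\Omega,i:\alpha$ infer $\Omega,\hat\nabla i:\nabla\alpha$. The translation $TWO$: to each truth value $t$ assign two lists of formulas in one variable $p$, "$\alpha$-formulas" and "$\beta$-formulas": $\mathbf 0$: $\alpha$'s $p,\nabla p$; $\beta$'s $\neg p$. $\frac13$: $\alpha$'s $p$; $\beta$'s $\neg p,\nabla p$. $\mathbf n$: $\alpha$'s $p,\neg p$; no $\beta$'s. $\mathbf b$: no $\alpha$'s;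 $\beta$'s $p,\neg p$. $\frac23$: $\alpha$'s $\neg p$; $\beta$'s $p,\nabla\neg p$. $\mathbf 1$: $\alpha$'s $\neg p,\nabla\neg p$; $\beta$'s $p$. Given a finite set $\Sigma$ of signed formulas, let $\Gamma_t=\{\psi\mid t:\psi\in\Sigma\}$. A partition $\pi$ of $\Sigma$ consists, for each $t$, of a partition of $\Gamma_t$ into (possibly empty) cells, one cell for each $\alpha$-formula and each $\beta$-formula assigned to $t$. The sequent $\Sigma_\pi$ has as left side the set of all $\theta[p/\psi]$ where $\theta$ is an $\alpha$-formula of some $t$ and $\psi$ lies in the cell of $\Gamma_t$ for $\theta$, and as right side the set of all $\theta[p/\psi]$ where $\theta$ is a $\beta$-formula of some $t$ and $\psi$ lies in the cell of $\Gamma_t$ for $\theta$. $TWO(\Sigma)$ is the set of all $\Sigma_\pi$, and for a set $S$ of sets of signed formulas $TWO(S)=\bigcup_{\Sigma\in S}TWO(\Sigma)$. $\mathbf{TS\text{-}Six}=TWO(\mathbf{SF\text{-}Six})$ is the calculus of ordinary sequents whose axioms are the members of $TWO(A)$ for each axiom $A$ of $\mathbf{SF\text{-}Six}$, and whose rules are: from $TWO(S)$ infer $\Sigma'$, for each rule instance of $\mathbf{SF\text{-}Six}$ with set of premises $S$ and conclusion $R$, and each $\Sigma'\in TWO(R)$. *)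

theory Defs
  imports Main "HOL-Library.Disjoint_Sets"
begin

section \<open>The matrix\<close>

datatype tv = Zero | Third | Neither | Both | TwoThirds | One

instantiation tv :: lattice
begin

definition less_eq_tv :: "tv \<Rightarrow> tv \<Rightarrow> bool" where
  "x \<le> y \<longleftrightarrow> x = y \<or> x = Zero \<or> y = One
     \<or> x = Third \<and> y \<in> {Neither, Both, TwoThirds}
     \<or> x \<in> {Neither, Both} \<and> y = TwoThirds"

definition less_tv :: "tv \<Rightarrow> tv \<Rightarrow> bool" where
  "x < y \<longleftrightarrow> x \<le> y \<and> \<not> y \<le> (x :: tv)"

text \<open>The only incomparable pair is \<open>Neither\<close>, \<open>Both\<close>; its infimum is \<open>Third\<close> and its
  supremum \<open>TwoThirds\<close>.\<close>

definition inf_tv :: "tv \<Rightarrow> tv \<Rightarrow> tv" where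
  "inf x y = (if x \<le> y then x else if y \<le> x then y else Third)"

definition sup_tv :: "tv \<Rightarrow> tv \<Rightarrow> tv" where
  "sup x y = (if x \<le> y then y else if y \<le> x then x else TwoThirds)"

instance
proof
  fix x y z :: tv
  show "x < y \<longleftrightarrow> x \<le> y \<and> \<not> y \<le> x" by (rule less_tv_def)
  show "x \<le> x" by (simp add: less_eq_tv_def)
  show "x \<le> y \<Longrightarrow> y \<le> z \<Longrightarrow> x \<le> z"
    by (cases x; cases y; cases z; simp add: less_eq_tv_def)
  show "x \<le> y \<Longrightarrow> y \<le> x \<Longrightarrow> x = y"
    by (cases x; cases y; simp add: less_eq_tv_def)
  show "inf x y \<le> x" "inf x y \<le> y" "x \<le> sup x y" "y \<le> sup x y"
    by (cases x; cases y; simp add: less_eq_tv_def inf_tv_def sup_tv_def)+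
  show "x \<le> y \<Longrightarrow> x \<le> z \<Longrightarrow> x \<le> inf y z"
    by (cases x; cases y; cases z; simp add: less_eq_tv_def inf_tv_def)
  show "y \<le> x \<Longrightarrow> z \<le> x \<Longrightarrow> sup y z \<le> x"
    by (cases x; cases y; cases z; simp add: less_eq_tv_def sup_tv_def)
qed

end

definition designated :: "tv set" where
  "designated = {Both, TwoThirds, One}"

fun neg_tv :: "tv \<Rightarrow> tv" where
  "neg_tv Zero = One"
| "neg_tv Third = TwoThirds"
| "neg_tv Neither = Neither"
| "neg_tv Both = Both"
| "neg_tv TwoThirds = Third"
| "neg_tv One = Zero"

definition nabla_tv :: "tv \<Rightarrow> tv" where
  "nabla_tv x = (if x = Zero then Zero else One)"

datatype fm = Var nat | Neg fm | Nabla fm | And fm fm | Or fm fm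

definition valuation :: "(fm \<Rightarrow> tv) \<Rightarrow> bool" where
  "valuation v \<longleftrightarrow>
     (\<forall>\<alpha>. v (Neg \<alpha>) = neg_tv (v \<alpha>)) \<and>
     (\<forall>\<alpha>. v (Nabla \<alpha>) = nabla_tv (v \<alpha>)) \<and>
     (\<forall>\<alpha> \<beta>. v (And \<alpha> \<beta>) = inf (v \<alpha>) (v \<beta>)) \<and>
     (\<forall>\<alpha> \<beta>. v (Or \<alpha> \<beta>) = sup (v \<alpha>) (v \<beta>))"

text \<open>Sequents consist of finite sets. The type also contains pairs of infinite sets, but
  every sequent derivable below is finite because the sets of signed formulas are.\<close>

type_synonym sequent = "fm set \<times> fm set"

definition satisfies :: "(fm \<Rightarrow> tv) \<Rightarrow> sequent \<Rightarrow> bool" where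
  "satisfies v s \<longleftrightarrow> (\<exists>\<gamma>\<in>fst s. v \<gamma> \<notin> designated) \<or> (\<exists>\<delta>\<in>snd s. v \<delta> \<in> designated)"

definition M6_valid :: "sequent \<Rightarrow> bool" where
  "M6_valid s \<longleftrightarrow> (\<forall>v. valuation v \<longrightarrow> satisfies v s)"

section \<open>The calculus of signed formulas\<close>

type_synonym signed = "tv \<times> fm"

inductive SF_axiom :: "signed set \<Rightarrow> bool" where
  "SF_axiom {(t, \<alpha>) | t. t \<in> (UNIV :: tv set)}"

text \<open>\<open>SF_rule S R\<close>: there is a rule instance with set of premises \<open>S\<close> and conclusion \<open>R\<close>.\<close>

inductive SF_rule :: "signed set set \<Rightarrow> signed set \<Rightarrow> bool" where
  Weakening: "finite \<Omega>' \<Longrightarrow> \<Omega> \<subseteq> \<Omega>' \<Longrightarrow> SF_rule {\<Omega>} \<Omega>'"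
| OrR: "finite \<Omega> \<Longrightarrow>
    SF_rule {\<Omega> \<union> {(i, \<alpha>)}, \<Omega> \<union> {(j, \<beta>)}} (\<Omega> \<union> {(sup i j, Or \<alpha> \<beta>)})"
| AndR: "finite \<Omega> \<Longrightarrow>
    SF_rule {\<Omega> \<union> {(i, \<alpha>)}, \<Omega> \<union> {(j, \<beta>)}} (\<Omega> \<union> {(inf i j, And \<alpha> \<beta>)})"
| NegR: "finite \<Omega> \<Longrightarrow> SF_rule {\<Omega> \<union> {(i, \<alpha>)}} (\<Omega> \<union> {(neg_tv i, Neg \<alpha>)})"
| NablaR: "finite \<Omega> \<Longrightarrow> SF_rule {\<Omega> \<union> {(i, \<alpha>)}} (\<Omega> \<union> {(nabla_tv i, Nabla \<alpha>)})"

section \<open>The translation into ordinary sequents\<close>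

primrec subst :: "fm \<Rightarrow> nat \<Rightarrow> fm \<Rightarrow> fm" where
  "subst (Var q) p \<psi> = (if q = p then \<psi> else Var q)"
| "subst (Neg \<alpha>) p \<psi> = Neg (subst \<alpha> p \<psi>)"
| "subst (Nabla \<alpha>) p \<psi> = Nabla (subst \<alpha> p \<psi>)"
| "subst (And \<alpha> \<beta>) p \<psi> = And (subst \<alpha> p \<psi>) (subst \<beta> p \<psi>)"
| "subst (Or \<alpha> \<beta>) p \<psi> = Or (subst \<alpha> p \<psi>) (subst \<beta> p \<psi>)"

text \<open>The variable \<open>p\<close> of the template formulas is \<open>Var 0\<close>.\<close>

fun alpha_fms :: "tv \<Rightarrow> fm list" where
  "alpha_fms Zero = [Var 0, Nabla (Var 0)]"
| "alpha_fms Third = [Var 0]"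
| "alpha_fms Neither = [Var 0, Neg (Var 0)]"
| "alpha_fms Both = []"
| "alpha_fms TwoThirds = [Neg (Var 0)]"
| "alpha_fms One = [Neg (Var 0), Nabla (Neg (Var 0))]"

fun beta_fms :: "tv \<Rightarrow> fm list" where
  "beta_fms Zero = [Neg (Var 0)]"
| "beta_fms Third = [Neg (Var 0), Nabla (Var 0)]"
| "beta_fms Neither = []"
| "beta_fms Both = [Var 0, Neg (Var 0)]"
| "beta_fms TwoThirds = [Var 0, Nabla (Neg (Var 0))]"
| "beta_fms One = [Var 0]"

text \<open>\<open>\<pi> t \<theta>\<close> is the cell for the formula \<open>\<theta>\<close> assigned to \<open>t\<close>. Cells can be indexed by \<open>\<theta>\<close>
  alone since no formula is listed twice for the same \<open>t\<close>; the values of \<open>\<pi> t\<close> at formulas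
  not assigned to \<open>t\<close> play no role.\<close>

definition is_partition :: "(tv \<Rightarrow> fm \<Rightarrow> fm set) \<Rightarrow> signed set \<Rightarrow> bool" where
  "is_partition \<pi> \<Sigma> \<longleftrightarrow> (\<forall>t.
     disjoint_family_on (\<pi> t) (set (alpha_fms t) \<union> set (beta_fms t)) \<and>
     (\<Union>\<theta>\<in>set (alpha_fms t) \<union> set (beta_fms t). \<pi> t \<theta>) = {\<psi>. (t, \<psi>) \<in> \<Sigma>})"

definition seq_of :: "(tv \<Rightarrow> fm \<Rightarrow> fm set) \<Rightarrow> sequent" where
  "seq_of \<pi> =
     ({subst \<theta> 0 \<psi> | \<theta> \<psi> t. \<theta> \<in> set (alpha_fms t) \<and> \<psi> \<in> \<pi> t \<theta>},
      {subst \<theta> 0 \<psi> | \<theta> \<psi> t. \<theta> \<in> set (beta_fms t) \<and> \<psi> \<in> \<pi> t \<theta>})"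

definition TWO :: "signed set \<Rightarrow> sequent set" where
  "TWO \<Sigma> = {seq_of \<pi> | \<pi>. is_partition \<pi> \<Sigma>}"

definition TWO_all :: "signed set set \<Rightarrow> sequent set" where
  "TWO_all S = (\<Union>\<Sigma>\<in>S. TWO \<Sigma>)"

definition TS_axiom :: "sequent \<Rightarrow> bool" where
  "TS_axiom s \<longleftrightarrow> (\<exists>A. SF_axiom A \<and> s \<in> TWO A)"

definition TS_rule :: "sequent set \<Rightarrow> sequent \<Rightarrow> bool" where
  "TS_rule P s \<longleftrightarrow> (\<exists>S R. SF_rule S R \<and> P = TWO_all S \<and> s \<in> TWO R)"

inductive TS_provable :: "sequent \<Rightarrow> bool" where
  Axiom: "TS_axiom s \<Longrightarrow> TS_provable s"
| Rule: "TS_rule P s \<Longrightarrow> (\<And>s'. s' \<in> P \<Longrightarrow> TS_provable s') \<Longrightarrow> TS_provable s"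

end

theory Submission
  imports Defs
begin

text \<open>
  Say that a valuation \<open>v\<close> satisfies a set \<open>\<Sigma>\<close> of signed formulas if \<open>v \<psi> = t\<close> for some
  \<open>(t, \<psi>) \<in> \<Sigma>\<close>. The template formulas are chosen so that \<open>v \<psi> = t\<close> holds exactly when every
  \<open>\<alpha>\<close>-formula of \<open>t\<close> is undesignated and every \<open>\<beta>\<close>-formula of \<open>t\<close> is designated at \<open>\<psi>\<close>
  (\<open>template_characterization\<close>). By distributivity, \<open>v\<close> satisfies \<open>\<Sigma>\<close> iff it satisfies every
  sequent in \<open>TWO \<Sigma>\<close> (\<open>satisfies_TWO_iff\<close>): if \<open>v\<close> fails on \<open>\<Sigma>\<close>, choosing for each signed
  formula a template that goes wrong gives a partition whose sequent is refuted. Hence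
  soundness of \<open>TS\<close> is inherited from that of the calculus of signed formulas.

  For completeness, derivations of signed sets translate step by step into derivations of all
  sequents of their translations (\<open>TWO_provable\<close>), so two things are needed. First, a sequent
  \<open>\<Gamma> \<Rightarrow> \<Delta>\<close> is itself a member of \<open>TWO \<Sigma>\<close>, where \<open>\<Sigma>\<close> gives the formulas of \<open>\<Gamma>\<close> all undesignated
  signs and those of \<open>\<Delta>\<close> all designated ones: \<open>p\<close> is an \<open>\<alpha>\<close>-formula of each undesignated value
  and a \<open>\<beta>\<close>-formula of each designated one (\<open>sequent_in_TWO\<close>). Second, the signed calculus is
  complete (\<open>SF_complete\<close>): an underivable valid finite set could be extended by signed variables
  to a maximal underivable \<open>\<Omega>\<close>. By the axioms some sign \<open>a p\<close> of each variable \<open>p\<close> is missing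
  from \<open>\<Omega>\<close>, by maximality \<open>\<Omega>, a p : p\<close> is derivable, and the logical rules then derive
  \<open>\<Omega>, eval a \<psi> : \<psi>\<close> for each formula \<open>\<psi>\<close>; one of these sets is \<open>\<Omega>\<close> itself.

  Admissibility of cut follows, as cut preserves validity.
\<close>

section \<open>Semantics of the translation\<close>

text \<open>Signed sets are read disjunctively.\<close>

definition sat_signed :: "(fm \<Rightarrow> tv) \<Rightarrow> signed set \<Rightarrow> bool" where
  "sat_signed v \<Sigma> \<longleftrightarrow> (\<exists>(t, \<psi>)\<in>\<Sigma>. v \<psi> = t)"

lemma template_characterization:
  assumes "valuation v"
  shows "v \<psi> = t \<longleftrightarrow>
    (\<forall>\<theta>\<in>set (alpha_fms t). v (subst \<theta> 0 \<psi>) \<notin> designated) \<and>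
    (\<forall>\<theta>\<in>set (beta_fms t). v (subst \<theta> 0 \<psi>) \<in> designated)"
  using assms
  by (cases t; cases "v \<psi>") (simp_all add: valuation_def designated_def nabla_tv_def)

lemma alpha_beta_disjoint: "set (alpha_fms t) \<inter> set (beta_fms t) = {}"
  by (cases t) auto

lemma satisfies_TWO_iff:
  assumes v: "valuation v"
  shows "(\<forall>s\<in>TWO \<Sigma>. satisfies v s) \<longleftrightarrow> sat_signed v \<Sigma>"
proof
  assume "sat_signed v \<Sigma>"
  then obtain t \<psi> where mem: "(t, \<psi>) \<in> \<Sigma>" and val: "v \<psi> = t"
    by (auto simp: sat_signed_def)
  show "\<forall>s\<in>TWO \<Sigma>. satisfies v s"
  proof
    fix s assume "s \<in> TWO \<Sigma>"
    then obtain \<pi> where s: "s = seq_of \<pi>" and \<pi>: "is_partition \<pi> \<Sigma>"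
      by (auto simp: TWO_def)
    obtain \<theta> where \<theta>: "\<theta> \<in> set (alpha_fms t) \<union> set (beta_fms t)" "\<psi> \<in> \<pi> t \<theta>"
      using \<pi> mem unfolding is_partition_def by blast
    show "satisfies v s"
    proof (cases "\<theta> \<in> set (alpha_fms t)")
      case True
      then have "subst \<theta> 0 \<psi> \<in> fst s"
        using \<theta> by (auto simp: s seq_of_def)
      moreover have "v (subst \<theta> 0 \<psi>) \<notin> designated"
        using True val template_characterization[OF v] by blast
      ultimately show ?thesis by (auto simp: satisfies_def)
    next
      case False
      then have "subst \<theta> 0 \<psi> \<in> snd s"
        using \<theta> by (auto simp: s seq_of_def)
      moreover have "v (subst \<theta> 0 \<psi>) \<in> designated"
        using False \<theta> val template_characterization[OF v] by blast
      ultimately show ?thesis by (auto simp: satisfies_def)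
    qed
  qed
next
  assume all: "\<forall>s\<in>TWO \<Sigma>. satisfies v s"
  show "sat_signed v \<Sigma>"
  proof (rule ccontr)
    assume no: "\<not> sat_signed v \<Sigma>"
    \<comment> \<open>The template \<open>\<theta>\<close> of \<open>t\<close> witnesses \<open>v \<psi> \<noteq> t\<close>: its instance at \<open>\<psi>\<close> has the wrong designation.\<close>
    define fails where "fails t \<psi> \<theta> \<longleftrightarrow>
      \<theta> \<in> set (alpha_fms t) \<and> v (subst \<theta> 0 \<psi>) \<in> designated \<or>
      \<theta> \<in> set (beta_fms t) \<and> v (subst \<theta> 0 \<psi>) \<notin> designated" for t \<psi> \<theta>
    have "\<exists>\<theta>. fails t \<psi> \<theta>" if "(t, \<psi>) \<in> \<Sigma>" for t \<psi>
    proof -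
      have "v \<psi> \<noteq> t" using that no by (auto simp: sat_signed_def)
      then show ?thesis
        using template_characterization[OF v] unfolding fails_def by blast
    qed
    then obtain c where c: "fails t \<psi> (c t \<psi>)" if "(t, \<psi>) \<in> \<Sigma>" for t \<psi>
      by metis
    define \<pi> where "\<pi> t \<theta> = {\<psi>. (t, \<psi>) \<in> \<Sigma> \<and> c t \<psi> = \<theta>}" for t \<theta>
    have "is_partition \<pi> \<Sigma>"
      using c unfolding is_partition_def \<pi>_def fails_def disjoint_family_on_def by blast
    then have "satisfies v (seq_of \<pi>)"
      using all unfolding TWO_def by blast
    moreover
    have "fails t \<psi> \<theta>" if "\<psi> \<in> \<pi> t \<theta>" for t \<psi> \<theta>
      using that c by (auto simp: \<pi>_def)
    then have "v (subst \<theta> 0 \<psi>) \<in> designated \<longleftrightarrow> \<theta> \<in> set (alpha_fms t)"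
      if "\<psi> \<in> \<pi> t \<theta>" for t \<psi> \<theta>
      using that alpha_beta_disjoint unfolding fails_def by blast
    then have "\<not> satisfies v (seq_of \<pi>)"
      using alpha_beta_disjoint unfolding satisfies_def seq_of_def by (auto simp: disjoint_iff)
    ultimately show False by blast
  qed
qed

section \<open>Soundness\<close>

lemma sat_SF_axiom: "SF_axiom A \<Longrightarrow> sat_signed v A"
  by (auto simp: SF_axiom.simps sat_signed_def)

lemma sat_SF_rule:
  assumes "valuation v" "SF_rule S R" "\<forall>\<Sigma>\<in>S. sat_signed v \<Sigma>"
  shows "sat_signed v R"
  using assms(2,1,3)
  by (cases rule: SF_rule.cases) (auto simp: sat_signed_def valuation_def)

lemma TS_sound:
  assumes "TS_provable s" "valuation v"
  shows "satisfies v s"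
  using assms(1)
proof induction
  case (Axiom s)
  then show ?case
    using sat_SF_axiom satisfies_TWO_iff[OF assms(2)] unfolding TS_axiom_def by blast
next
  case (Rule P s)
  obtain S R where SR: "SF_rule S R" "P = TWO_all S" "s \<in> TWO R"
    using Rule.hyps by (auto simp: TS_rule_def)
  have "\<forall>\<Sigma>\<in>S. sat_signed v \<Sigma>"
    using Rule.IH SR(2) satisfies_TWO_iff[OF assms(2)] unfolding TWO_all_def by blast
  then have "sat_signed v R"
    using sat_SF_rule assms(2) SR(1) by blast
  then show ?case
    using SR(3) satisfies_TWO_iff[OF assms(2)] by blast
qed

section \<open>Completeness of the calculus of signed formulas\<close>

text \<open>Derivability in the calculus given by \<open>SF_axiom\<close> and \<open>SF_rule\<close>.\<close>

inductive SF_provable :: "signed set \<Rightarrow> bool" where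
  SF_Ax: "SF_axiom A \<Longrightarrow> SF_provable A"
| SF_Ru: "SF_rule S R \<Longrightarrow> (\<And>\<Sigma>. \<Sigma> \<in> S \<Longrightarrow> SF_provable \<Sigma>) \<Longrightarrow> SF_provable R"

lemma SF_weaken: "SF_provable \<Omega> \<Longrightarrow> finite \<Omega>' \<Longrightarrow> \<Omega> \<subseteq> \<Omega>' \<Longrightarrow> SF_provable \<Omega>'"
  using SF_Ru[OF Weakening] by blast

text \<open>The valuation determined by an assignment \<open>a\<close> of truth values to the variables.\<close>

primrec eval :: "(nat \<Rightarrow> tv) \<Rightarrow> fm \<Rightarrow> tv" where
  "eval a (Var p) = a p"
| "eval a (Neg \<alpha>) = neg_tv (eval a \<alpha>)"
| "eval a (Nabla \<alpha>) = nabla_tv (eval a \<alpha>)"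
| "eval a (And \<alpha> \<beta>) = inf (eval a \<alpha>) (eval a \<beta>)"
| "eval a (Or \<alpha> \<beta>) = sup (eval a \<alpha>) (eval a \<beta>)"

lemma valuation_eval: "valuation (eval a)"
  by (simp add: valuation_def)

text \<open>The variables that occur in a formula.\<close>

primrec vars :: "fm \<Rightarrow> nat set" where
  "vars (Var p) = {p}"
| "vars (Neg \<alpha>) = vars \<alpha>"
| "vars (Nabla \<alpha>) = vars \<alpha>"
| "vars (And \<alpha> \<beta>) = vars \<alpha> \<union> vars \<beta>"
| "vars (Or \<alpha> \<beta>) = vars \<alpha> \<union> vars \<beta>"

lemma finite_vars: "finite (vars \<psi>)"
  by (induction \<psi>) auto

lemma finite_UNIV_tv: "finite (UNIV :: tv set)"
proof -
  have "(UNIV :: tv set) = {Zero, Third, Neither, Both, TwoThirds, One}"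
    using tv.exhaust by blast
  moreover have "finite {Zero, Third, Neither, Both, TwoThirds, One}" by blast
  ultimately show ?thesis by metis
qed

text \<open>The logical rules act on signs as the connectives act on truth values, so they lift
  derivability from the variables of a formula to the formula, over a fixed side set.\<close>

lemma SF_provable_eval:
  assumes fin: "finite \<Omega>"
    and "\<And>p. p \<in> vars \<psi> \<Longrightarrow> SF_provable (\<Omega> \<union> {(a p, Var p)})"
  shows "SF_provable (\<Omega> \<union> {(eval a \<psi>, \<psi>)})"
  using assms(2)
proof (induction \<psi>)
  case (Var p)
  then show ?case by simp
next
  case (Neg \<alpha>)
  then show ?case using SF_Ru[OF NegR[OF fin, of "eval a \<alpha>" \<alpha>]] by simp
next
  case (Nabla \<alpha>)
  then show ?case using SF_Ru[OF NablaR[OF fin, of "eval a \<alpha>" \<alpha>]] by simp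
next
  case (And \<alpha> \<beta>)
  then show ?case
    using SF_Ru[OF AndR[OF fin, of "eval a \<alpha>" \<alpha> "eval a \<beta>" \<beta>]] by auto
next
  case (Or \<alpha> \<beta>)
  then show ?case
    using SF_Ru[OF OrR[OF fin, of "eval a \<alpha>" \<alpha> "eval a \<beta>" \<beta>]] by auto
qed

lemma SF_complete:
  assumes fin: "finite \<Sigma>" and valid: "\<And>v. valuation v \<Longrightarrow> sat_signed v \<Sigma>"
  shows "SF_provable \<Sigma>"
proof (rule ccontr)
  assume unprov: "\<not> SF_provable \<Sigma>"
  \<comment> \<open>\<open>\<Omega>\<close> will be maximal among the underivable extensions of \<open>\<Sigma>\<close> by signed variables
    of \<open>\<Sigma>\<close>; restricting to these keeps the search space \<open>B\<close> finite.\<close>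
  define V where "V = (\<Union>(t, \<psi>)\<in>\<Sigma>. vars \<psi>)"
  define B where "B = \<Sigma> \<union> UNIV \<times> Var ` V"
  define F where "F = {\<Omega>. \<Omega> \<subseteq> B \<and> \<not> SF_provable \<Omega>}"
  have "finite V"
    using fin finite_vars by (auto simp: V_def)
  then have finB: "finite B"
    using fin finite_UNIV_tv by (simp add: B_def finite_cartesian_product)
  then have "finite F"
    unfolding F_def by simp
  moreover have "\<Sigma> \<in> F"
    using unprov by (simp add: F_def B_def)
  ultimately obtain \<Omega> where "\<Omega> \<in> F" and sub: "\<Sigma> \<subseteq> \<Omega>"
      and max: "\<And>\<Omega>'. \<Omega>' \<in> F \<Longrightarrow> \<Omega> \<subseteq> \<Omega>' \<Longrightarrow> \<Omega> = \<Omega>'"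
    by (meson finite_has_maximal2)
  then have \<Omega>B: "\<Omega> \<subseteq> B" and un\<Omega>: "\<not> SF_provable \<Omega>"
    by (auto simp: F_def)
  have fin\<Omega>: "finite \<Omega>"
    using \<Omega>B finB finite_subset by blast
  have "\<exists>t. (t, Var p) \<notin> \<Omega>" for p
  proof (rule ccontr)
    assume "\<nexists>t. (t, Var p) \<notin> \<Omega>"
    then have "{(t, Var p) |t. t \<in> UNIV} \<subseteq> \<Omega>" by auto
    then show False
      using SF_weaken[OF SF_Ax[OF SF_axiom.intros] fin\<Omega>] un\<Omega> by blast
  qed
  then obtain a where a: "\<And>p. (a p, Var p) \<notin> \<Omega>" by metis
  have atoms: "SF_provable (\<Omega> \<union> {(a p, Var p)})" if "p \<in> V" for p
  proof (rule ccontr)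
    assume "\<not> SF_provable (\<Omega> \<union> {(a p, Var p)})"
    then have "\<Omega> \<union> {(a p, Var p)} \<in> F"
      using that \<Omega>B by (auto simp: F_def B_def)
    then show False using max a[of p] by blast
  qed
  obtain \<psi> where \<psi>: "(eval a \<psi>, \<psi>) \<in> \<Sigma>"
    using valid[OF valuation_eval[of a]] by (auto simp: sat_signed_def)
  then have "vars \<psi> \<subseteq> V" by (auto simp: V_def)
  then have "SF_provable (\<Omega> \<union> {(eval a \<psi>, \<psi>)})"
    using SF_provable_eval[OF fin\<Omega>] atoms by blast
  moreover have "\<Omega> \<union> {(eval a \<psi>, \<psi>)} = \<Omega>"
    using \<psi> sub by auto
  ultimately show False using un\<Omega> by simp
qed

section \<open>Transfer to ordinary sequents\<close>

lemma TWO_provable: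
  assumes "SF_provable \<Sigma>" "s \<in> TWO \<Sigma>"
  shows "TS_provable s"
  using assms
proof (induction arbitrary: s)
  case (SF_Ax A)
  then show ?case using TS_provable.Axiom unfolding TS_axiom_def by blast
next
  case (SF_Ru S R)
  have "TS_rule (TWO_all S) s"
    using SF_Ru.hyps(1) SF_Ru.prems by (auto simp: TS_rule_def)
  then show ?case
    using SF_Ru.IH TS_provable.Rule unfolding TWO_all_def by blast
qed

text \<open>The signed counterpart of a sequent: it is satisfied by the same valuations.\<close>

definition signed_of :: "sequent \<Rightarrow> signed set" where
  "signed_of s = (- designated) \<times> fst s \<union> designated \<times> snd s"

lemma sat_signed_of: "sat_signed v (signed_of s) \<longleftrightarrow> satisfies v s"
  by (auto simp: sat_signed_def signed_of_def satisfies_def)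

lemma Var_alpha_iff: "Var 0 \<in> set (alpha_fms t) \<longleftrightarrow> t \<notin> designated"
  by (cases t) (auto simp: designated_def)

lemma Var_beta_iff: "Var 0 \<in> set (beta_fms t) \<longleftrightarrow> t \<in> designated"
  by (cases t) (auto simp: designated_def)

lemma sequent_in_TWO: "s \<in> TWO (signed_of s)"
proof -
  \<comment> \<open>Every formula goes to the cell of the template \<open>p\<close>, whose instances are the formulas themselves.\<close>
  define \<pi> where "\<pi> t \<theta> =
    (if \<theta> = Var 0 then if t \<in> designated then snd s else fst s else {})" for t :: tv and \<theta>
  have "is_partition \<pi> (signed_of s)"
    unfolding is_partition_def
  proof (intro allI conjI)
    fix t
    show "disjoint_family_on (\<pi> t) (set (alpha_fms t) \<union> set (beta_fms t))"
      by (auto simp: disjoint_family_on_def \<pi>_def)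
    have "Var 0 \<in> set (alpha_fms t) \<union> set (beta_fms t)"
      using Var_alpha_iff Var_beta_iff by blast
    then have "(\<Union>\<theta>\<in>set (alpha_fms t) \<union> set (beta_fms t). \<pi> t \<theta>) = \<pi> t (Var 0)"
      by (auto simp: \<pi>_def split: if_splits)
    then show "(\<Union>\<theta>\<in>set (alpha_fms t) \<union> set (beta_fms t). \<pi> t \<theta>) = {\<psi>. (t, \<psi>) \<in> signed_of s}"
      by (auto simp: \<pi>_def signed_of_def)
  qed
  moreover have "seq_of \<pi> = s"
  proof (rule prod_eqI)
    have "fst (seq_of \<pi>) = {\<psi>. \<exists>t. t \<notin> designated \<and> \<psi> \<in> fst s}"
      using Var_alpha_iff by (fastforce simp: seq_of_def \<pi>_def split: if_splits)
    moreover have "Zero \<notin> designated" by (simp add: designated_def)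
    ultimately show "fst (seq_of \<pi>) = fst s" by blast
    have "snd (seq_of \<pi>) = {\<psi>. \<exists>t. t \<in> designated \<and> \<psi> \<in> snd s}"
      using Var_beta_iff by (fastforce simp: seq_of_def \<pi>_def split: if_splits)
    moreover have "One \<in> designated" by (simp add: designated_def)
    ultimately show "snd (seq_of \<pi>) = snd s" by blast
  qed
  ultimately show ?thesis by (auto simp: TWO_def)
qed

lemma TS_complete:
  assumes "finite \<Gamma>" "finite \<Delta>" "M6_valid (\<Gamma>, \<Delta>)"
  shows "TS_provable (\<Gamma>, \<Delta>)"
proof -
  have "finite (signed_of (\<Gamma>, \<Delta>))"
    using assms(1,2) finite_subset[OF subset_UNIV finite_UNIV_tv] by (simp add: signed_of_def)
  then have "SF_provable (signed_of (\<Gamma>, \<Delta>))"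
    by (rule SF_complete) (use assms(3) in \<open>simp add: sat_signed_of M6_valid_def\<close>)
  then show ?thesis
    using TWO_provable sequent_in_TWO by blast
qed

section \<open>Adequacy and admissibility of cut\<close>

theorem proposition4p3:
  shows "(\<forall>\<Gamma> \<Delta>. finite \<Gamma> \<and> finite \<Delta> \<longrightarrow>
            (TS_provable (\<Gamma>, \<Delta>) \<longleftrightarrow> M6_valid (\<Gamma>, \<Delta>)))
       \<and> (\<forall>\<Gamma> \<Delta> \<alpha>. finite \<Gamma> \<and> finite \<Delta> \<longrightarrow>
            TS_provable (\<Gamma>, \<Delta> \<union> {\<alpha>}) \<longrightarrow> TS_provable ({\<alpha>} \<union> \<Gamma>, \<Delta>) \<longrightarrow>
            TS_provable (\<Gamma>, \<Delta>))"
proof (intro conjI allI impI)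
  fix \<Gamma> \<Delta> :: "fm set"
  assume "finite \<Gamma> \<and> finite \<Delta>"
  then show "TS_provable (\<Gamma>, \<Delta>) \<longleftrightarrow> M6_valid (\<Gamma>, \<Delta>)"
    using TS_sound TS_complete by (auto simp: M6_valid_def)
next
  fix \<Gamma> \<Delta> :: "fm set" and \<alpha>
  assume fin: "finite \<Gamma> \<and> finite \<Delta>"
    and prems: "TS_provable (\<Gamma>, \<Delta> \<union> {\<alpha>})" "TS_provable ({\<alpha>} \<union> \<Gamma>, \<Delta>)"
  have "M6_valid (\<Gamma>, \<Delta>)"
    unfolding M6_valid_def
  proof (intro allI impI)
    fix v assume "valuation v"
    then have "satisfies v (\<Gamma>, \<Delta> \<union> {\<alpha>})" "satisfies v ({\<alpha>} \<union> \<Gamma>, \<Delta>)"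
      using prems TS_sound by auto
    then show "satisfies v (\<Gamma>, \<Delta>)"
      by (auto simp: satisfies_def)
  qed
  then show "TS_provable (\<Gamma>, \<Delta>)"
    using fin TS_complete by blast
qed

end
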